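(* For every integer $n\geq 2$, the $n$-book graph satisfies $\chi_D(B_n)=\lceil\sqrt{n}\,\rceil+1$ or $\chi_D(B_n)=\lceil\sqrt{n}\,\rceil+2$. More precisely, writing $\lceil\sqrt{n}\,\rceil=m+1$ with $m\geq 1$ an integer: (i) $\chi_D(B_n)=\lceil\sqrt{n}\,\rceil+1$ whenever $m^2<n\leq m^2+m+1$; (ii) $\chi_D(B_n)=\lceil\sqrt{n}\,\rceil+2$ whenever $m^2+m+2\leq n\leq (m+1)^2$.
   Context: The $n$-book graph $B_n$ ($n\geq 2$) is the Cartesian product of the star $K_{1,n}$ and the path $P_2$ on two vertices; concretely it has vertices $v_0,w_0,v_1,w_1,\dots,v_n,w_n$ and edges $v_0w_0$, $v_0v_i$, $w_0w_i$, $v_iw_i$ for $1\leq i\leq n$. A vertex coloring is distinguishing if the only automorphism preserving all vertex colors is the identity. The distinguishing chromatic number $\chi_D(G)$ is the minimum $r$ such that $G$ has a proper distinguishing coloring with $r$ colors. *)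

theory Defs
  imports Complex_Main
begin

record 'a graph =
  verts :: "'a set"
  edges :: "'a set set"

definition simple_graph :: "'a graph \<Rightarrow> bool" where
  "simple_graph G \<longleftrightarrow> finite (verts G) \<and> (\<forall>e\<in>edges G. e \<subseteq> verts G \<and> card e = 2)"

definition star_graph :: "nat \<Rightarrow> nat graph" where
  "star_graph n = \<lparr>verts = {0..n}, edges = {{0, i} | i. 1 \<le> i \<and> i \<le> n}\<rparr>"

definition path_graph :: "nat \<Rightarrow> nat graph" where
  "path_graph k = \<lparr>verts = {..<k}, edges = {{i, Suc i} | i. Suc i < k}\<rparr>"

definition cartesian_product :: "'a graph \<Rightarrow> 'b graph \<Rightarrow> ('a \<times> 'b) graph" where
  "cartesian_product G H =
     \<lparr>verts = verts G \<times> verts H,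
      edges = {{(u, x), (v, x)} | u v x. {u, v} \<in> edges G \<and> x \<in> verts H}
            \<union> {{(u, x), (u, y)} | u x y. u \<in> verts G \<and> {x, y} \<in> edges H}\<rparr>"

text \<open>The vertex \<open>v\<^sub>i\<close> is \<open>(i, 0)\<close> and \<open>w\<^sub>i\<close> is \<open>(i, 1)\<close>.\<close>

definition book_graph :: "nat \<Rightarrow> (nat \<times> nat) graph" where
  "book_graph n = cartesian_product (star_graph n) (path_graph 2)"

definition automorphism :: "'a graph \<Rightarrow> ('a \<Rightarrow> 'a) \<Rightarrow> bool" where
  "automorphism G f \<longleftrightarrow> bij_betw f (verts G) (verts G) \<and>
     (\<forall>u\<in>verts G. \<forall>v\<in>verts G. {f u, f v} \<in> edges G \<longleftrightarrow> {u, v} \<in> edges G)"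

definition proper_coloring :: "'a graph \<Rightarrow> ('a \<Rightarrow> 'c) \<Rightarrow> bool" where
  "proper_coloring G c \<longleftrightarrow> (\<forall>u\<in>verts G. \<forall>v\<in>verts G. {u, v} \<in> edges G \<longrightarrow> c u \<noteq> c v)"

definition distinguishing_coloring :: "'a graph \<Rightarrow> ('a \<Rightarrow> 'c) \<Rightarrow> bool" where
  "distinguishing_coloring G c \<longleftrightarrow>
     (\<forall>f. automorphism G f \<and> (\<forall>v\<in>verts G. c (f v) = c v) \<longrightarrow> (\<forall>v\<in>verts G. f v = v))"

definition distinguishing_chromatic_number :: "'a graph \<Rightarrow> nat" ("\<chi>\<^sub>D") where
  "\<chi>\<^sub>D G = (LEAST r. \<exists>c. c ` verts G \<subseteq> {..<r} \<and>
                      proper_coloring G c \<and> distinguishing_coloring G c)"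

lemma verts_book_graph: "verts (book_graph n) = {0..n} \<times> {0, 1}"
  by (auto simp: book_graph_def cartesian_product_def star_graph_def path_graph_def)

lemma edges_book_graph:
  "edges (book_graph n) =
     {{(0, 0), (0, 1)}} \<union> (\<Union>i\<in>{1..n}. {{(0, 0), (i, 0)}, {(0, 1), (i, 1)}, {(i, 0), (i, 1)}})"
  (is "?L = ?R")
proof
  show "?L \<subseteq> ?R"
  proof
    fix e assume "e \<in> ?L"
    then consider
        (star) u v x where "e = {(u, x), (v, x)}" "{u, v} \<in> edges (star_graph n)" "x \<in> verts (path_graph 2)"
      | (path) u x y where "e = {(u, x), (u, y)}" "u \<in> verts (star_graph n)" "{x, y} \<in> edges (path_graph 2)"
      unfolding book_graph_def cartesian_product_def by auto
    then show "e \<in> ?R"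
    proof cases
      case star
      then obtain i where i: "{u, v} = {0, i}" "i \<in> {1..n}"
        by (auto simp: star_graph_def)
      have "e = (\<lambda>a. (a, x)) ` {u, v}" using star by simp
      then have e: "e = {(0, x), (i, x)}" unfolding i by simp
      have "x = 0 \<or> x = 1" using star by (auto simp: path_graph_def)
      then show ?thesis unfolding e using i(2) by blast
    next
      case path
      then have xy: "{x, y} = {0, 1}" by (simp add: path_graph_def)
      have "e = Pair u ` {x, y}" using path by simp
      then have e: "e = {(u, 0), (u, 1)}" unfolding xy by simp
      have "u = 0 \<or> u \<in> {1..n}" using path by (auto simp: star_graph_def)
      then show ?thesis unfolding e by blast
    qed
  qed
  have star: "{(0, x), (i, x)} \<in> ?L" if "1 \<le> i" "i \<le> n" "x < 2" for i x
  proof -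
    have "{0, i} \<in> edges (star_graph n)" "x \<in> verts (path_graph 2)"
      using that by (auto simp: star_graph_def path_graph_def)
    then show ?thesis unfolding book_graph_def cartesian_product_def by auto
  qed
  have path: "{(i, 0), (i, 1)} \<in> ?L" if "i \<le> n" for i
  proof -
    have "{0, 1} \<in> edges (path_graph 2)" "i \<in> verts (star_graph n)"
      using that by (auto simp: star_graph_def path_graph_def)
    then show ?thesis unfolding book_graph_def cartesian_product_def by auto
  qed
  show "?R \<subseteq> ?L"
  proof (intro Un_least UN_least subsetI)
    fix e :: "(nat \<times> nat) set" assume "e \<in> {{(0, 0), (0, 1)}}"
    then show "e \<in> ?L" using path[of 0] by simp
  next
    fix i :: nat and e :: "(nat \<times> nat) set"
    assume "i \<in> {1..n}" "e \<in> {{(0, 0), (i, 0)}, {(0, 1), (i, 1)}, {(i, 0), (i, 1)}}"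
    then show "e \<in> ?L" using star[of i 0] star[of i 1] path[of i] by (elim insertE) simp_all
  qed
qed

lemma simple_graph_book_graph: "simple_graph (book_graph n)"
  by (auto simp: simple_graph_def verts_book_graph edges_book_graph)

lemma ex_proper_distinguishing_coloring:
  assumes "simple_graph G"
  shows "\<exists>r c. c ` verts G \<subseteq> {..<r::nat} \<and> proper_coloring G c \<and> distinguishing_coloring G c"
proof -
  obtain c and r :: nat where c: "c ` verts G = {i. i < r}" "inj_on c (verts G)"
    using finite_imp_inj_to_nat_seg[of "verts G"] assms unfolding simple_graph_def by metis
  have "u \<noteq> v" if "{u, v} \<in> edges G" for u v
    using assms that unfolding simple_graph_def by fastforce
  then have "proper_coloring G c"
    using c(2) unfolding proper_coloring_def inj_on_def by blast
  moreover have "distinguishing_coloring G c"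
    using c(2) unfolding distinguishing_coloring_def automorphism_def
    by (meson bij_betwE inj_onD)
  ultimately show ?thesis using c(1) by (intro exI[of _ r] exI[of _ c]) auto
qed

end

theory Submission
  imports Defs "HOL-Combinatorics.Transposition"
begin

text \<open>
  For \<open>n \<ge> 2\<close> the spine vertices are the only ones of degree greater than 2, so every automorphism
  preserves the spine. In a proper coloring the two spine vertices have distinct colors \<open>a \<noteq> b\<close>;
  hence a color-preserving automorphism fixes the spine and permutes the pages, and the coloring is
  distinguishing iff the pages carry distinct color pairs. With \<open>k + 1\<close> colors there are
  \<open>k\<^sup>2 - (k - 1)\<close> admissible pairs \<open>(x, y)\<close> with \<open>x \<noteq> a\<close>, \<open>y \<noteq> b\<close>, \<open>x \<noteq> y\<close>. So \<open>k + 1\<close> colors suffice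
  iff \<open>k \<ge> 1\<close> and \<open>n \<le> k\<^sup>2 - k + 1\<close>.
\<close>

text \<open>Coordinate form of the edge set: it covers both orientations of every edge, so later
  adjacency claims become arithmetic on indices.\<close>

lemma book_graph_adjacent_iff:
  "{(i, s), (j, t)} \<in> edges (book_graph n) \<longleftrightarrow>
     i \<le> n \<and> j \<le> n \<and> s < 2 \<and> t < 2 \<and>
     (i = j \<and> s \<noteq> t \<or> s = t \<and> i \<noteq> j \<and> (i = 0 \<or> j = 0))"
proof
  assume "{(i, s), (j, t)} \<in> edges (book_graph n)"
  then have "{(i, s), (j, t)} = {(0, 0), (0, 1)} \<or>
     (\<exists>k\<in>{1..n}. {(i, s), (j, t)} = {(0, 0), (k, 0)} \<or> {(i, s), (j, t)} = {(0, 1), (k, 1)} \<or>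
        {(i, s), (j, t)} = {(k, 0), (k, 1)})"
    by (simp only: edges_book_graph Un_iff UN_iff insert_iff empty_iff simp_thms)
  then show "i \<le> n \<and> j \<le> n \<and> s < 2 \<and> t < 2 \<and>
     (i = j \<and> s \<noteq> t \<or> s = t \<and> i \<noteq> j \<and> (i = 0 \<or> j = 0))"
    by (elim disjE bexE) (auto simp: doubleton_eq_iff)
next
  assume "i \<le> n \<and> j \<le> n \<and> s < 2 \<and> t < 2 \<and>
     (i = j \<and> s \<noteq> t \<or> s = t \<and> i \<noteq> j \<and> (i = 0 \<or> j = 0))"
  then consider "i = j" "i \<le> n" "s = 0 \<and> t = 1 \<or> s = 1 \<and> t = 0"
    | "i = 0" "j \<in> {1..n}" "s = t" "s = 0 \<or> s = 1" | "j = 0" "i \<in> {1..n}" "s = t" "s = 0 \<or> s = 1"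
    by (auto simp: less_2_cases_iff)
  then have "{(i, s), (j, t)} = {(0, 0), (0, 1)} \<or>
     (\<exists>k\<in>{1..n}. {(i, s), (j, t)} = {(0, 0), (k, 0)} \<or> {(i, s), (j, t)} = {(0, 1), (k, 1)} \<or>
        {(i, s), (j, t)} = {(k, 0), (k, 1)})"
    by cases (cases "i = 0"; force simp: doubleton_eq_iff)+
  then show "{(i, s), (j, t)} \<in> edges (book_graph n)"
    by (simp only: edges_book_graph Un_iff UN_iff insert_iff empty_iff simp_thms)
qed

lemma mem_verts_book_graph: "(i, s) \<in> verts (book_graph n) \<longleftrightarrow> i \<le> n \<and> s < 2"
  by (auto simp: verts_book_graph)

section \<open>Counting admissible color pairs of a page\<close>

text \<open>Here \<open>a\<close>, \<open>b\<close> stand for the spine colors and \<open>x\<close>,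
  \<open>y\<close> for those of \<open>(i, 0)\<close>, \<open>(i, 1)\<close>; each inequation comes
  from one of the three edges that page \<open>i\<close> adds.\<close>

definition page_color_pairs :: "nat \<Rightarrow> nat \<Rightarrow> nat \<Rightarrow> (nat \<times> nat) set" where
  "page_color_pairs r a b = {(x, y). x < r \<and> y < r \<and> x \<noteq> a \<and> y \<noteq> b \<and> x \<noteq> y}"

lemma finite_page_color_pairs: "finite (page_color_pairs r a b)"
  by (rule finite_subset[of _ "{..<r} \<times> {..<r}"]) (auto simp: page_color_pairs_def)

lemma card_page_color_pairs:
  assumes "a < Suc k" "b < Suc k" "a \<noteq> b"
  shows "card (page_color_pairs (Suc k) a b) = k * k - (k - 1)"
proof -
  let ?A = "({..<Suc k} - {a}) \<times> ({..<Suc k} - {b})"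
  \<comment> \<open>The diagonal pairs to discard. As \<open>a \<noteq> b\<close>, two of the
    \<open>k + 1\<close> colors are excluded here, leaving \<open>k - 1\<close>.\<close>
  let ?D = "(\<lambda>x. (x, x)) ` ({..<Suc k} - {a, b})"
  have "page_color_pairs (Suc k) a b = ?A - ?D"
    by (auto simp: page_color_pairs_def)
  moreover have "card ?D = k - 1"
    using assms by (subst card_image) (auto simp: inj_on_def card_Diff_subset)
  moreover have "card ?A = k * k"
    using assms by (simp add: card_cartesian_product card_Diff_subset)
  moreover have "?D \<subseteq> ?A" by auto
  ultimately show ?thesis by (simp add: card_Diff_subset)
qed

section \<open>Automorphisms and distinguishing colorings\<close>

text \<open>Adjacency depends only on equality of indices, on which index is 0 and on the second
  coordinates; exchanging two positive indices preserves all of these.\<close>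

lemma automorphism_swap_pages:
  assumes "i \<in> {1..n}" "j \<in> {1..n}"
  shows "automorphism (book_graph n) (map_prod (Transposition.transpose i j) id)"
proof -
  let ?f = "map_prod (Transposition.transpose i j) id :: nat \<times> nat \<Rightarrow> nat \<times> nat"
  have le: "Transposition.transpose i j k \<le> n \<longleftrightarrow> k \<le> n" for k
    using assms by (auto simp: Transposition.transpose_def)
  have zero: "Transposition.transpose i j k = 0 \<longleftrightarrow> k = 0" for k
    using assms by (auto simp: Transposition.transpose_def)
  have inj: "Transposition.transpose i j k = Transposition.transpose i j l \<longleftrightarrow> k = l" for k l
    by (auto simp: Transposition.transpose_def)
  have "bij_betw ?f (verts (book_graph n)) (verts (book_graph n))"
    by (rule bij_betw_byWitness[where f' = ?f]) (auto simp: mem_verts_book_graph le)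
  then show ?thesis
    by (auto simp: automorphism_def book_graph_adjacent_iff le zero inj)
qed

text \<open>A degree argument: a spine vertex has at least three neighbors, whose distinct images
  would not fit among the two neighbors of a page vertex.\<close>

lemma spine_image:
  assumes f: "automorphism (book_graph n) f" and n: "n \<ge> 2" and s: "s < 2"
  shows "fst (f (0, s)) = 0"
proof (rule ccontr)
  assume ne: "fst (f (0, s)) \<noteq> 0"
  obtain i t where it: "f (0, s) = (i, t)" by fastforce
  have inj: "inj_on f (verts (book_graph n))"
    using f by (auto simp: automorphism_def bij_betw_def)
  have nbr: "f (j, u) \<in> {(0, t), (i, 1 - t)}" if "{(0, s), (j, u)} \<in> edges (book_graph n)" for j u
  proof -
    obtain j' u' where ju: "f (j, u) = (j', u')" by fastforce
    have "{f (0, s), f (j, u)} \<in> edges (book_graph n)"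
      using f that s unfolding automorphism_def
      by (auto simp: book_graph_adjacent_iff mem_verts_book_graph)
    then show ?thesis
      using ne unfolding it ju book_graph_adjacent_iff by auto
  qed
  \<comment> \<open>Three neighbors of \<open>(0, s)\<close>; the third exists because
    \<open>n \<ge> 2\<close>.\<close>
  let ?N = "{(0, 1 - s), (1, s), (2, s)} :: (nat \<times> nat) set"
  have "f ` ?N \<subseteq> {(0, t), (i, 1 - t)}"
    using nbr[of 0 "1 - s"] nbr[of 1 s] nbr[of 2 s] s n
    by (auto simp: book_graph_adjacent_iff less_2_cases_iff)
  then have "card (f ` ?N) \<le> card {(0, t), (i, 1 - t)}"
    by (intro card_mono) auto
  also have "\<dots> \<le> 2" by (simp add: card_insert_if)
  finally have "card (f ` ?N) \<le> 2" .
  moreover have "card (f ` ?N) = card ?N"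
    using s n by (intro card_image inj_on_subset[OF inj]) (auto simp: mem_verts_book_graph)
  ultimately show False by simp
qed

lemma distinguishing_coloring_book_graph_iff:
  fixes c :: "nat \<times> nat \<Rightarrow> 'c"
  assumes n: "n \<ge> 2" and c: "proper_coloring (book_graph n) c"
  shows "distinguishing_coloring (book_graph n) c \<longleftrightarrow> inj_on (\<lambda>i. (c (i, 0), c (i, 1))) {1..n}"
proof
  assume dist: "distinguishing_coloring (book_graph n) c"
  show "inj_on (\<lambda>i. (c (i, 0), c (i, 1))) {1..n}"
  proof (rule inj_onI)
    fix i j assume ij: "i \<in> {1..n}" "j \<in> {1..n}" "(c (i, 0), c (i, 1)) = (c (j, 0), c (j, 1))"
    let ?f = "map_prod (Transposition.transpose i j) id :: nat \<times> nat \<Rightarrow> nat \<times> nat"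
    have "\<forall>v\<in>verts (book_graph n). c (?f v) = c v"
      using ij(3) by (auto simp: verts_book_graph Transposition.transpose_def)
    then have "\<forall>v\<in>verts (book_graph n). ?f v = v"
      using dist automorphism_swap_pages[OF ij(1,2)] unfolding distinguishing_coloring_def by blast
    moreover have "(i, 0) \<in> verts (book_graph n)"
      using ij(1) by (simp add: mem_verts_book_graph)
    ultimately have "?f (i, 0) = (i, 0)" by blast
    then show "i = j" by simp
  qed
next
  assume inj: "inj_on (\<lambda>i. (c (i, 0), c (i, 1))) {1..n}"
  show "distinguishing_coloring (book_graph n) c"
    unfolding distinguishing_coloring_def
  proof (intro allI impI ballI; elim conjE)
    fix f v
    assume f: "automorphism (book_graph n) f" and v: "v \<in> verts (book_graph n)"
      and col: "\<forall>v\<in>verts (book_graph n). c (f v) = c v"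
    have maps: "f u \<in> verts (book_graph n)" if "u \<in> verts (book_graph n)" for u
      using f that by (auto simp: automorphism_def dest: bij_betwE)
    have f_inj: "inj_on f (verts (book_graph n))"
      using f by (auto simp: automorphism_def bij_betw_def)
    \<comment> \<open>The spine is mapped to itself; different colors at its ends rule out the
      flip.\<close>
    have "c (0, 0) \<noteq> c (0, 1)"
      using c unfolding proper_coloring_def by (auto simp: mem_verts_book_graph book_graph_adjacent_iff)
    then have spine: "f (0, s) = (0, s)" if "s < 2" for s
      using spine_image[OF f n that] that maps[of "(0, s)"] bspec[OF col, of "(0, s)"]
      by (cases "f (0, s)") (auto simp: mem_verts_book_graph less_2_cases_iff)
    have page: "\<exists>j\<in>{1..n}. f (i, s) = (j, s)" if "i \<in> {1..n}" "s < 2" for i s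
    proof -
      obtain j t where jt: "f (i, s) = (j, t)" by fastforce
      have "{f (0, s), f (i, s)} \<in> edges (book_graph n)"
        using f that unfolding automorphism_def
        by (auto simp: book_graph_adjacent_iff mem_verts_book_graph)
      \<comment> \<open>Both spine vertices are already images of themselves, so injectivity keeps
        page vertices off the spine.\<close>
      moreover have "j \<noteq> 0"
      proof
        assume "j = 0"
        then have "f (i, s) = f (0, t)" "t < 2"
          using spine[of t] jt maps[of "(i, s)"] that by (auto simp: mem_verts_book_graph)
        then have "(i, s) = (0, t)"
          using that inj_onD[OF f_inj, of "(i, s)" "(0, t)"] by (simp add: mem_verts_book_graph)
        then show False using that by simp
      qed
      \<comment> \<open>The image is a page vertex adjacent to the fixed \<open>(0, s)\<close>,
        hence lies on the same side.\<close>
      ultimately have "t = s" "j \<in> {1..n}"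
        using spine[OF that(2)] by (auto simp: jt book_graph_adjacent_iff)
      then show ?thesis using jt by blast
    qed
    have pages: "f (i, 0) = (i, 0) \<and> f (i, 1) = (i, 1)" if i: "i \<in> {1..n}" for i
    proof -
      obtain j j' where j: "f (i, 0) = (j, 0)" "j \<in> {1..n}" "f (i, 1) = (j', 1)"
        using page[OF i, of 0] page[OF i, of 1] by auto
      have "{f (i, 0), f (i, 1)} \<in> edges (book_graph n)"
        using f i unfolding automorphism_def
        by (auto simp: book_graph_adjacent_iff mem_verts_book_graph)
      \<comment> \<open>Adjacent vertices on opposite sides share their index, so a page moves as a
        whole.\<close>
      then have [simp]: "j' = j" using j by (auto simp: book_graph_adjacent_iff)
      have "c (f (i, 0)) = c (i, 0)" "c (f (i, 1)) = c (i, 1)"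
        using col i by (auto simp: mem_verts_book_graph)
      then have "j = i" using inj_onD[OF inj, of j i] i j by simp
      then show ?thesis using j by simp
    qed
    obtain i s where "v = (i, s)" by fastforce
    then show "f v = v"
      using v spine[of s] pages[of i] by (cases "i = 0") (auto simp: mem_verts_book_graph less_2_cases_iff)
  qed
qed

section \<open>How many colors suffice\<close>

lemma ex_coloring_book_graph_iff:
  assumes n: "n \<ge> 2"
  shows "(\<exists>c. c ` verts (book_graph n) \<subseteq> {..<Suc k} \<and> proper_coloring (book_graph n) c \<and>
              distinguishing_coloring (book_graph n) c) \<longleftrightarrow> 1 \<le> k \<and> n \<le> k * k - (k - 1)"
    (is "?L \<longleftrightarrow> ?R")
proof
  assume ?L
  then obtain c where c: "c ` verts (book_graph n) \<subseteq> {..<Suc k}"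
    and proper: "proper_coloring (book_graph n) c"
    and "distinguishing_coloring (book_graph n) c" by blast
  then have inj: "inj_on (\<lambda>i. (c (i, 0), c (i, 1))) {1..n}" (is "inj_on ?p _")
    using distinguishing_coloring_book_graph_iff[OF n] by blast
  have bound: "c (i, s) < Suc k" if "i \<le> n" "s < 2" for i s
    using c that by (auto simp: image_subset_iff mem_verts_book_graph)
  have adj: "c (i, s) \<noteq> c (j, t)" if "{(i, s), (j, t)} \<in> edges (book_graph n)" for i s j t
    using proper that unfolding proper_coloring_def
    by (auto simp: book_graph_adjacent_iff mem_verts_book_graph)
  have ab: "c (0, 0) < Suc k" "c (0, 1) < Suc k" "c (0, 0) \<noteq> c (0, 1)"
    using bound adj by (simp_all add: book_graph_adjacent_iff)
  have "?p i \<in> page_color_pairs (Suc k) (c (0, 0)) (c (0, 1))" if "i \<in> {1..n}" for i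
    using that bound[of i 0] bound[of i 1] adj[of i 0 0 0] adj[of i 1 0 1] adj[of i 0 i 1]
    by (simp add: page_color_pairs_def book_graph_adjacent_iff)
  then have "card {1..n} \<le> card (page_color_pairs (Suc k) (c (0, 0)) (c (0, 1)))"
    by (intro card_inj_on_le[OF inj] finite_page_color_pairs) blast
  then show ?R
    using ab by (simp add: card_page_color_pairs)
next
  assume k: ?R
  then have "n \<le> card (page_color_pairs (Suc k) 0 1)"
    using card_page_color_pairs[of 0 k 1] by linarith
  then have "card {1..n} \<le> card (page_color_pairs (Suc k) 0 1)" by simp
  then obtain g where g: "g ` {1..n} \<subseteq> page_color_pairs (Suc k) 0 1" "inj_on g {1..n}"
    using card_le_inj[OF finite_atLeastAtMost finite_page_color_pairs] by blast
  \<comment> \<open>The spine gets colors 0 and 1, both available since \<open>k \<ge> 1\<close>;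
    page \<open>i\<close> gets the pair \<open>g i\<close>.\<close>
  define c :: "nat \<times> nat \<Rightarrow> nat" where
    "c = (\<lambda>(i, s). if i = 0 then s else if s = 0 then fst (g i) else snd (g i))"
  have g_pair: "fst (g i) < Suc k" "snd (g i) < Suc k" "fst (g i) \<noteq> 0" "snd (g i) \<noteq> 1"
    "fst (g i) \<noteq> snd (g i)" if "1 \<le> i" "i \<le> n" for i
  proof -
    have "g i \<in> page_color_pairs (Suc k) 0 1" using g(1) that by auto
    then show "fst (g i) < Suc k" "snd (g i) < Suc k" "fst (g i) \<noteq> 0" "snd (g i) \<noteq> 1"
      "fst (g i) \<noteq> snd (g i)" by (auto simp: page_color_pairs_def)
  qed
  have "c ` verts (book_graph n) \<subseteq> {..<Suc k}"
    using g_pair k by (auto simp: c_def mem_verts_book_graph simp del: not_less_eq)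
  moreover have "proper_coloring (book_graph n) c"
    unfolding proper_coloring_def
  proof (intro ballI impI)
    fix u v assume "{u, v} \<in> edges (book_graph n)"
    then show "c u \<noteq> c v"
      using g_pair[of "fst u"] g_pair[of "fst v"]
      by (cases u; cases v) (auto simp: c_def book_graph_adjacent_iff less_2_cases_iff)
  qed
  moreover have "inj_on (\<lambda>i. (c (i, 0), c (i, 1))) {1..n}"
    using g(2) by (subst inj_on_cong[where g = g]) (auto simp: c_def)
  ultimately show ?L
    using distinguishing_coloring_book_graph_iff[OF n] by blast
qed

text \<open>\<open>upper\<close> says that \<open>k + 1\<close> colors suffice, \<open>lower\<close>
  that \<open>k\<close> colors do not.\<close>

lemma distinguishing_chromatic_number_book_graph_eqI:
  assumes n: "n \<ge> 2" and k: "k \<ge> 1"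
    and upper: "n \<le> k * k - (k - 1)" and lower: "(k - 1) * (k - 1) - (k - 2) < n"
  shows "\<chi>\<^sub>D (book_graph n) = Suc k"
  unfolding distinguishing_chromatic_number_def
proof (rule Least_equality)
  show "\<exists>c. c ` verts (book_graph n) \<subseteq> {..<Suc k} \<and> proper_coloring (book_graph n) c \<and>
            distinguishing_coloring (book_graph n) c"
    using ex_coloring_book_graph_iff[OF n] k upper by blast
next
  fix r :: nat
  assume "\<exists>c. c ` verts (book_graph n) \<subseteq> {..<r} \<and> proper_coloring (book_graph n) c \<and>
              distinguishing_coloring (book_graph n) c"
  then obtain c where c: "c ` verts (book_graph n) \<subseteq> {..<r}" "proper_coloring (book_graph n) c"
    "distinguishing_coloring (book_graph n) c" by blast
  show "Suc k \<le> r"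
  proof (rule ccontr)
    assume "\<not> Suc k \<le> r"
    \<comment> \<open>A palette of \<open>r \<le> k\<close> colors lies inside one of exactly
      \<open>k = Suc (k - 1)\<close> colors, so one failing case excludes all smaller
      \<open>r\<close>.\<close>
    then have "c ` verts (book_graph n) \<subseteq> {..<Suc (k - 1)}" using c(1) by auto
    then have "n \<le> (k - 1) * (k - 1) - (k - 1 - 1)"
      using ex_coloring_book_graph_iff[OF n, of "k - 1"] c(2,3) by blast
    then show False using lower by (simp add: numeral_2_eq_2)
  qed
qed

section \<open>Ceilings of square roots and the two ranges of \<open>n\<close>\<close>

lemma ceiling_sqrt_eq_Suc_iff:
  "\<lceil>sqrt (real n)\<rceil> = int m + 1 \<longleftrightarrow> m\<^sup>2 < n \<and> n \<le> (m + 1)\<^sup>2"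
proof -
  have "real m < sqrt (real n) \<longleftrightarrow> m\<^sup>2 < n"
    using real_sqrt_less_iff[of "real (m\<^sup>2)" "real n"] by (simp del: real_sqrt_less_iff)
  moreover have "sqrt (real n) \<le> real m + 1 \<longleftrightarrow> n \<le> (m + 1)\<^sup>2"
    using real_sqrt_le_iff[of "real n" "real ((m + 1)\<^sup>2)"]
    by (simp only: of_nat_le_iff) (simp add: add.commute)
  ultimately show ?thesis by (simp add: ceiling_eq_iff)
qed

theorem theorem5p10:
  fixes n :: nat
  assumes "n \<ge> 2"
  shows "(int (\<chi>\<^sub>D (book_graph n)) = \<lceil>sqrt (real n)\<rceil> + 1 \<or>
          int (\<chi>\<^sub>D (book_graph n)) = \<lceil>sqrt (real n)\<rceil> + 2) \<and>
         (\<exists>m::nat. m \<ge> 1 \<and> \<lceil>sqrt (real n)\<rceil> = int m + 1) \<and>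
         (\<forall>m::nat. m \<ge> 1 \<and> \<lceil>sqrt (real n)\<rceil> = int m + 1 \<longrightarrow>
            (m\<^sup>2 < n \<and> n \<le> m\<^sup>2 + m + 1 \<longrightarrow>
               int (\<chi>\<^sub>D (book_graph n)) = \<lceil>sqrt (real n)\<rceil> + 1) \<and>
            (m\<^sup>2 + m + 2 \<le> n \<and> n \<le> (m + 1)\<^sup>2 \<longrightarrow>
               int (\<chi>\<^sub>D (book_graph n)) = \<lceil>sqrt (real n)\<rceil> + 2))"
proof -
  have small: "int (\<chi>\<^sub>D (book_graph n)) = \<lceil>sqrt (real n)\<rceil> + 1"
    if "m \<ge> 1" "\<lceil>sqrt (real n)\<rceil> = int m + 1" "m\<^sup>2 < n" "n \<le> m\<^sup>2 + m + 1" for m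
  proof -
    \<comment> \<open>With \<open>k = m + 1\<close> the upper bound is
      \<open>(m + 1)\<^sup>2 - m = m\<^sup>2 + m + 1\<close>, and the lower one is at most
      \<open>m\<^sup>2\<close>.\<close>
    have "\<chi>\<^sub>D (book_graph n) = Suc (m + 1)"
    proof (rule distinguishing_chromatic_number_book_graph_eqI[OF assms])
      show "n \<le> (m + 1) * (m + 1) - (m + 1 - 1)"
        using that(4) by (simp add: power2_eq_square)
      show "(m + 1 - 1) * (m + 1 - 1) - (m + 1 - 2) < n"
        using that(3) by (simp add: power2_eq_square)
    qed simp
    then show ?thesis using that(2) by simp
  qed
  have large: "int (\<chi>\<^sub>D (book_graph n)) = \<lceil>sqrt (real n)\<rceil> + 2"
    if "m \<ge> 1" "\<lceil>sqrt (real n)\<rceil> = int m + 1" "m\<^sup>2 + m + 2 \<le> n" "n \<le> (m + 1)\<^sup>2" for m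
  proof -
    \<comment> \<open>With \<open>k = m + 2\<close> the lower bound is
      \<open>m\<^sup>2 + m + 1\<close>, and the upper one is \<open>m\<^sup>2 + 3 * m + 3\<close>,
      beyond \<open>(m + 1)\<^sup>2\<close>.\<close>
    have "\<chi>\<^sub>D (book_graph n) = Suc (m + 2)"
    proof (rule distinguishing_chromatic_number_book_graph_eqI[OF assms])
      show "n \<le> (m + 2) * (m + 2) - (m + 2 - 1)"
        using that(4) by (simp add: power2_eq_square)
      show "(m + 2 - 1) * (m + 2 - 1) - (m + 2 - 2) < n"
        using that(3) by (simp add: power2_eq_square)
    qed simp
    then show ?thesis using that(2) by simp
  qed
  have "1 < sqrt (real n)" using assms by simp
  then have "1 < \<lceil>sqrt (real n)\<rceil>" by (simp add: less_ceiling_iff)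
  define m where "m = nat (\<lceil>sqrt (real n)\<rceil> - 1)"
  have m: "m \<ge> 1" "\<lceil>sqrt (real n)\<rceil> = int m + 1"
    using \<open>1 < \<lceil>sqrt (real n)\<rceil>\<close> unfolding m_def by linarith+
  have "m\<^sup>2 < n" "n \<le> (m + 1)\<^sup>2"
    using m(2) by (simp_all add: ceiling_sqrt_eq_Suc_iff)
  \<comment> \<open>The two ranges meet without a gap at \<open>m\<^sup>2 + m + 1\<close>, so they
    exhaust the interval for \<open>n\<close>.\<close>
  then have "int (\<chi>\<^sub>D (book_graph n)) = \<lceil>sqrt (real n)\<rceil> + 1 \<or>
             int (\<chi>\<^sub>D (book_graph n)) = \<lceil>sqrt (real n)\<rceil> + 2"
    using small[OF m] large[OF m] by linarith
  then show ?thesis using m small large by blast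
qed

end
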